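(* For every positive integer $k$, as $n \to \infty$, $$d_{K_{1,2k}}(n)=\Theta_k\!\left(\frac{1}{n^k}\right) \quad\text{and}\quad d_{M_{2k}}(n)=\Theta_k\!\left(\frac{1}{n^k}\right),$$ where the constants implicit in $\Theta_k$ depend only on $k$.
   Context: For a graph $H$ and an integer $n$, a family $\mathcal{F}$ of graphs on the vertex set $[n]=\{1,\dots,n\}$ is called an $H$-code if no two distinct members $G_1=([n],E_1)$, $G_2=([n],E_2)$ of $\mathcal{F}$ have symmetric difference $([n],E_1\oplus E_2)$ isomorphic to $H$ (isolated vertices ignored, i.e. the edge set $E_1\oplus E_2$ forms a copy of $H$ in the complete graph on $[n]$). Let $D_H(n)$ be the maximum cardinality of an $H$-code on $[n]$ and $d_H(n)=D_H(n)/2^{\binom{n}{2}}$. $K_{1,t}$ denotes the star with $t$ edges and $M_t$ denotes the matching with $t$ edges. *)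

theory Defs
  imports Complex_Main "HOL-Library.Landau_Symbols"
begin

type_synonym 'a graph = "'a set \<times> 'a set set"

abbreviation verts :: "'a graph \<Rightarrow> 'a set" where "verts G \<equiv> fst G"
abbreviation edges :: "'a graph \<Rightarrow> 'a set set" where "edges G \<equiv> snd G"

definition simple_graph :: "'a graph \<Rightarrow> bool" where
  "simple_graph G \<longleftrightarrow> (\<forall>e\<in>edges G. e \<subseteq> verts G \<and> card e = 2)"

definition graph_iso :: "'a graph \<Rightarrow> 'b graph \<Rightarrow> bool" where
  "graph_iso G H \<longleftrightarrow> (\<exists>f. bij_betw f (verts G) (verts H) \<and>
     (\<forall>u\<in>verts G. \<forall>v\<in>verts G. {u, v} \<in> edges G \<longleftrightarrow> {f u, f v} \<in> edges H))"

definition drop_isolated :: "'a graph \<Rightarrow> 'a graph" where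
  "drop_isolated G = ({v \<in> verts G. \<exists>e\<in>edges G. v \<in> e}, edges G)"

definition graphs_on :: "nat \<Rightarrow> nat graph set" where
  "graphs_on n = {G. simple_graph G \<and> verts G = {1..n}}"

definition H_code :: "'a graph \<Rightarrow> nat \<Rightarrow> nat graph set \<Rightarrow> bool" where
  "H_code H n \<F> \<longleftrightarrow> \<F> \<subseteq> graphs_on n \<and>
     (\<forall>G\<^sub>1\<in>\<F>. \<forall>G\<^sub>2\<in>\<F>. G\<^sub>1 \<noteq> G\<^sub>2 \<longrightarrow>
        \<not> graph_iso (drop_isolated ({1..n}, sym_diff (edges G\<^sub>1) (edges G\<^sub>2))) (drop_isolated H))"

definition max_code :: "'a graph \<Rightarrow> nat \<Rightarrow> nat" where
  "max_code H n = Max (card ` {\<F>. H_code H n \<F>})"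

definition code_density :: "'a graph \<Rightarrow> nat \<Rightarrow> real" where
  "code_density H n = real (max_code H n) / 2 ^ (n choose 2)"

text \<open>The star with centre \<open>0\<close> and leaves \<open>1, \<dots>, t\<close>.\<close>
definition star :: "nat \<Rightarrow> nat graph" where
  "star t = ({0..t}, {{0, i} | i. i \<in> {1..t}})"

definition matching :: "nat \<Rightarrow> nat graph" where
  "matching t = ({0..<2 * t}, {{2 * i, 2 * i + 1} | i. i < t})"

text \<open>The maximum in \<open>max_code\<close> is over a finite nonempty set, hence attained.\<close>

lemma finite_graphs_on: "finite (graphs_on n)"
proof (rule finite_subset)
  show "graphs_on n \<subseteq> {{1..n}} \<times> Pow (Pow {1..n})"
    unfolding graphs_on_def simple_graph_def by fastforce
qed auto

lemma finite_codes: "finite {\<F>. H_code H n \<F>}"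
  by (rule finite_subset[of _ "Pow (graphs_on n)"]) (auto simp: H_code_def finite_graphs_on)

lemma max_code_attained: "\<exists>\<F>. H_code H n \<F> \<and> card \<F> = max_code H n"
proof -
  have "H_code H n {}"
    by (simp add: H_code_def)
  then have "max_code H n \<in> card ` {\<F>. H_code H n \<F>}"
    unfolding max_code_def by (intro Max_in finite_imageI finite_codes) blast
  then show ?thesis by auto
qed

lemma H_code_card_le: "H_code H n \<F> \<Longrightarrow> card \<F> \<le> max_code H n"
  unfolding max_code_def by (simp add: finite_codes)

end

theory Submission
  imports Defs "HOL-Library.Ramsey" "HOL-Library.Z2" "HOL-Algebra.Algebraic_Closure_Type"
begin

text \<open>
  Lower bounds. Label the edges by elements of \<open>GF(2^m)\<close>, \<open>n \<le> 2^m < 2n\<close>, so that the edges of every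
  copy of the star or matching get distinct labels: for an injection \<open>g\<close> of the vertices, take
  \<open>g u + g v\<close> for the star and \<open>g (min u v)\<close> for the matching. As in a BCH code, group the
  graphs by the \<open>k\<close> power sums of exponents \<open>1, 3, \<dots>, 2k - 1\<close> of their labels. Two graphs of one
  group differ in a set with vanishing power sums; with \<open>2k\<close> distinct labels this would make all
  power sums of exponent below \<open>2k\<close> vanish, contradicting Lagrange interpolation. So the largest of
  the at most \<open>(2n)^k\<close> groups is a code.

  Upper bounds. Partition linearly many potential star or matching edges into \<open>r\<close> blocks of \<open>M\<close> edges. Each
  \<open>x \<in> [M]^r\<close> selects one edge per block, and if \<open>x\<close>, \<open>y\<close> differ in exactly \<open>k\<close> coordinates, then
  the selected edge sets differ by a copy of \<open>H\<close>. Averaging over translates, it suffices that every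
  \<open>F \<subseteq> [M]^r\<close> without pairs at Hamming distance \<open>k\<close> has size \<open>O(M^(r-k))\<close>. Following the
  delta-system method of Frankl and Fueredi, pass to a homogeneous subfamily in which every kind of
  sunflower that occurs occurs at every member. Then \<open>F\<close> realises every union of occurring petal sets as the
  set of coordinates where two members differ. If \<open>F\<close> is large, every \<open>k\<close>-set of coordinates contains a
  petal set, and for \<open>r\<close> large, Ramsey's theorem yields a \<open>k\<close>-set that is a union of petal sets.
\<close>

section \<open>Families avoiding a Hamming distance\<close>

definition differ :: "('i \<Rightarrow> 'a) \<Rightarrow> ('i \<Rightarrow> 'a) \<Rightarrow> 'i set" where
  "differ x y = {c. x c \<noteq> y c}"

text \<open>With a function \<open>x\<close> read as the set of pairs \<open>(c, x c)\<close>, this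
  is a delta-system: the members agree outside \<open>J\<close>, and their petals, the parts over
  \<open>J\<close>, are pairwise disjoint. Petals are recorded by their coordinates alone.\<close>

definition sunflower :: "'i set \<Rightarrow> ('i \<Rightarrow> 'a) set \<Rightarrow> bool" where
  "sunflower J Y \<longleftrightarrow> (\<forall>x\<in>Y. \<forall>y\<in>Y. x \<noteq> y \<longrightarrow> differ x y = J)"

lemma differ_eq_empty_iff [simp]: "differ x y = {} \<longleftrightarrow> x = y"
  by (auto simp: differ_def)

lemma differ_commute: "differ x y = differ y x"
  by (auto simp: differ_def)

lemma differ_subset_PiE:
  assumes "x \<in> I \<rightarrow>\<^sub>E A" "y \<in> I \<rightarrow>\<^sub>E A"
  shows "differ x y \<subseteq> I"
proof
  fix c assume "c \<in> differ x y"
  then show "c \<in> I"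
    using PiE_arb[OF assms(1), of c] PiE_arb[OF assms(2), of c] by (cases "c \<in> I") (auto simp: differ_def)
qed

lemma card_UN_bound:
  assumes "finite P" "\<And>p. p \<in> P \<Longrightarrow> card (A p) \<le> b"
  shows "card (\<Union>p\<in>P. A p) \<le> card P * b"
  using order_trans[OF card_UN_le[OF assms(1)] sum_bounded_above[OF assms(2)]] by simp

text \<open>The Erdos-Rado argument, by induction on the number of coordinates. A maximal subfamily
  whose members pairwise differ on all of \<open>I\<close> either has \<open>s\<close> members, or
  is so small that many members of \<open>S\<close> agree with a fixed member of it in a fixed
  coordinate \<open>c\<close>; those differ only inside \<open>I - {c}\<close>.\<close>

lemma sunflower_exists:
  "\<exists>b. \<forall>(I :: 'i set) S :: ('i \<Rightarrow> 'a) set. finite I \<longrightarrow> card I = m \<longrightarrow> finite S \<longrightarrow>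
     (\<forall>x\<in>S. \<forall>y\<in>S. differ x y \<subseteq> I) \<longrightarrow> card S > b \<longrightarrow>
     (\<exists>J Y. J \<subseteq> I \<and> Y \<subseteq> S \<and> card Y = s \<and> sunflower J Y)"
proof (induction m)
  case 0
  have "card S \<le> 1" if "finite S" "\<forall>x\<in>S. \<forall>y\<in>S. differ x y \<subseteq> {}" for S :: "('i \<Rightarrow> 'a) set"
    using that card_le_Suc0_iff_eq[of S] by auto
  then show ?case
    by (intro exI[of _ 1] allI impI) (metis card_0_eq leD)
next
  case (Suc m)
  then obtain b where "\<forall>(I :: 'i set) S :: ('i \<Rightarrow> 'a) set. finite I \<longrightarrow> card I = m \<longrightarrow> finite S \<longrightarrow>
     (\<forall>x\<in>S. \<forall>y\<in>S. differ x y \<subseteq> I) \<longrightarrow> card S > b \<longrightarrow>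
     (\<exists>J Y. J \<subseteq> I \<and> Y \<subseteq> S \<and> card Y = s \<and> sunflower J Y)" ..
  note b = this[rule_format]
  show ?case
  proof (intro exI[of _ "s * Suc m * b"] allI impI)
    fix I :: "'i set" and S :: "('i \<Rightarrow> 'a) set"
    assume I: "finite I" "card I = Suc m" and S: "finite S" "\<forall>x\<in>S. \<forall>y\<in>S. differ x y \<subseteq> I"
      and big: "s * Suc m * b < card S"
    define \<Y> where "\<Y> = {Y. Y \<subseteq> S \<and> sunflower I Y}"
    have "finite \<Y>" "{} \<in> \<Y>"
      using S by (auto simp: \<Y>_def sunflower_def)
    then obtain Y where Y: "Y \<in> \<Y>" "\<forall>Z\<in>\<Y>. Y \<subseteq> Z \<longrightarrow> Y = Z"
      using finite_has_maximal by (metis empty_iff)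
    have finY: "finite Y"
      using Y S by (auto simp: \<Y>_def intro: finite_subset)
    show "\<exists>J Y. J \<subseteq> I \<and> Y \<subseteq> S \<and> card Y = s \<and> sunflower J Y"
    proof (cases "s \<le> card Y")
      case True
      then obtain Z where "Z \<subseteq> Y" "card Z = s"
        by (meson obtain_subset_with_card_n)
      then show ?thesis
        using Y(1) by (intro exI[of _ I] exI[of _ Z]) (auto simp: \<Y>_def sunflower_def)
    next
      case False
      \<comment> \<open>By maximality of \<open>Y\<close> these classes cover \<open>S\<close>.
        There are at most \<open>s * Suc m\<close> of them, whence the threshold.\<close>
      define A where "A = (\<lambda>(y, c). {x\<in>S. x c = y c})"
      have "S \<subseteq> (\<Union>p\<in>Y \<times> I. A p)"
      proof
        fix x assume x: "x \<in> S"
        have "\<exists>y\<in>Y. differ x y \<noteq> I"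
        proof (cases "x \<in> Y")
          case True
          then show ?thesis
            using I(2) by (intro bexI[of _ x]) (auto simp: differ_def)
        next
          case False
          then have "insert x Y \<notin> \<Y>"
            using Y(2) by blast
          then show ?thesis
            using x Y(1) by (auto simp: \<Y>_def sunflower_def differ_commute)
        qed
        then obtain y c where "y \<in> Y" "c \<in> I" "x c = y c"
          using S(2) x Y(1) by (fastforce simp: \<Y>_def differ_def)
        then show "x \<in> (\<Union>p\<in>Y \<times> I. A p)"
          using x by (auto simp: A_def)
      qed
      then have "card S \<le> card (\<Union>p\<in>Y \<times> I. A p)"
        using S(1) finY I(1) by (intro card_mono) (auto simp: A_def)
      have "\<exists>p\<in>Y \<times> I. card (A p) > b"
      proof (rule ccontr)
        assume "\<not> ?thesis"
        then have "card (\<Union>p\<in>Y \<times> I. A p) \<le> card (Y \<times> I) * b"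
          using finY I(1) by (intro card_UN_bound) (auto simp: not_less)
        also have "\<dots> \<le> s * Suc m * b"
          unfolding card_cartesian_product I(2) using False by (intro mult_right_mono) auto
        finally show False
          using big \<open>card S \<le> _\<close> by linarith
      qed
      then obtain y c where c: "c \<in> I" "card (A (y, c)) > b"
        by auto
      have "\<forall>x\<in>A (y, c). \<forall>y'\<in>A (y, c). differ x y' \<subseteq> I - {c}"
        using S(2) by (fastforce simp: A_def differ_def)
      then obtain J Y' where "J \<subseteq> I - {c}" "Y' \<subseteq> A (y, c)" "card Y' = s" "sunflower J Y'"
        using b[of "I - {c}" "A (y, c)"] I c S(1) by (auto simp: A_def)
      then show ?thesis
        by (intro exI[of _ J] exI[of _ Y']) (auto simp: A_def)
    qed
  qed
qed

section \<open>Homogeneous subfamilies\<close>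

definition petals :: "nat \<Rightarrow> ('i \<Rightarrow> 'a) set \<Rightarrow> 'i set set" where
  "petals s F = {J. \<exists>Y\<subseteq>F. card Y = s \<and> sunflower J Y}"

text \<open>\<open>W\<close> is a parameter because the petal sets shrink with the family. The goal
  is \<open>W = petals s F\<close>: whatever petal set occurs at all then occurs at every
  member.\<close>

definition homogeneous :: "nat \<Rightarrow> 'i set set \<Rightarrow> ('i \<Rightarrow> 'a) set \<Rightarrow> bool" where
  "homogeneous s W F \<longleftrightarrow> (\<forall>J\<in>W. \<forall>x\<in>F. \<exists>Y\<subseteq>F. x \<in> Y \<and> card Y = s \<and> sunflower J Y)"

lemma petals_mono: "F \<subseteq> G \<Longrightarrow> petals s F \<subseteq> petals s G"
  unfolding petals_def by blast


text \<open>Remove, as long as possible, an element lying in no \<open>J\<close>-sunflower of what is left, and put it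
  into \<open>D J\<close>. The element of a sunflower inside \<open>D J\<close> that was removed first contradicts its removal.\<close>

lemma homogeneous_part:
  assumes "finite F"
  shows "\<exists>F' D. F' \<subseteq> F \<and> homogeneous s W F' \<and> (\<forall>J\<in>W. D J \<subseteq> F \<and> (s > 0 \<longrightarrow> J \<notin> petals s (D J))) \<and>
           F \<subseteq> F' \<union> (\<Union>J\<in>W. D J)"
  using assms
proof (induction "card F" arbitrary: F)
  case 0
  then show ?case
    by (intro exI[of _ "{}"] exI[of _ "\<lambda>_. {}"]) (auto simp: homogeneous_def petals_def)
next
  case (Suc m)
  show ?case
  proof (cases "homogeneous s W F")
    case True
    then show ?thesis
      by (intro exI[of _ F] exI[of _ "\<lambda>_. {}"]) (auto simp: petals_def)
  next
    case False
    then obtain J x where J: "J \<in> W" "x \<in> F" "\<And>Y. Y \<subseteq> F \<Longrightarrow> x \<in> Y \<Longrightarrow> card Y = s \<Longrightarrow> \<not> sunflower J Y"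
      unfolding homogeneous_def by blast
    have "m = card (F - {x})" "finite (F - {x})"
      using Suc.hyps(2) Suc.prems J(2) by auto
    then obtain F' D where *: "F' \<subseteq> F - {x}" "homogeneous s W F'"
      "\<forall>J\<in>W. D J \<subseteq> F - {x} \<and> (s > 0 \<longrightarrow> J \<notin> petals s (D J))" "F - {x} \<subseteq> F' \<union> (\<Union>J\<in>W. D J)"
      using Suc.hyps(1)[of "F - {x}"] by auto
    let ?D = "D(J := insert x (D J))"
    have "J \<notin> petals s (insert x (D J))" if "s > 0"
    proof
      assume "J \<in> petals s (insert x (D J))"
      then obtain Y where Y: "Y \<subseteq> insert x (D J)" "card Y = s" "sunflower J Y"
        by (auto simp: petals_def)
      have "insert x (D J) \<subseteq> F"
        using * J by blast
      then have "x \<notin> Y"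
        using J(3)[of Y] Y by blast
      then have "Y \<subseteq> D J"
        using Y(1) by blast
      then show False
        using * J(1) Y that by (auto simp: petals_def)
    qed
    then have "\<forall>K\<in>W. ?D K \<subseteq> F \<and> (s > 0 \<longrightarrow> K \<notin> petals s (?D K))"
      using * J by auto
    moreover have "F \<subseteq> F' \<union> (\<Union>K\<in>W. ?D K)"
      using * J by (auto split: if_splits)
    ultimately show ?thesis
      using * by (intro exI[of _ F'] exI[of _ ?D]) blast
  qed
qed

text \<open>Of the \<open>card W + 1\<close> pieces given by \<open>homogeneous_part\<close>, one
  holds a share of at least \<open>1 / (card W + 1)\<close> of \<open>F\<close>. If it is
  \<open>F'\<close>, this is the subfamily sought; if it is some \<open>D J\<close>, the petal set
  \<open>J\<close> has disappeared and the induction continues with \<open>W - {J}\<close>. Each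
  round costs a factor of at most \<open>card W + 1\<close>.\<close>

lemma homogeneous_subfamily:
  assumes "finite F" "s > 0" "finite W" "petals s F \<subseteq> W"
  shows "\<exists>F'\<subseteq>F. homogeneous s (petals s F') F' \<and> card F \<le> Suc (card W) ^ Suc (card W) * card F'"
  using assms
proof (induction "card W" arbitrary: F W rule: less_induct)
  case less
  obtain F' D where *: "F' \<subseteq> F" "homogeneous s W F'" "\<forall>J\<in>W. D J \<subseteq> F \<and> J \<notin> petals s (D J)"
      "F \<subseteq> F' \<union> (\<Union>J\<in>W. D J)"
    using homogeneous_part[OF less.prems(1), of s W] less.prems(2) by auto
  have hom: "homogeneous s (petals s F') F'"
    using *(2) petals_mono[OF *(1), of s] less.prems(4) unfolding homogeneous_def by blast
  let ?w = "card W"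
  show ?case
  proof (cases "card F \<le> Suc ?w * card F'")
    case True
    also have "Suc ?w * card F' \<le> Suc ?w ^ Suc ?w * card F'"
      by (intro mult_right_mono) (use self_le_power[of "Suc ?w" "Suc ?w"] in simp_all)
    finally show ?thesis
      using * hom by blast
  next
    case False
    \<comment> \<open>If every \<open>D J\<close> had at most its proportional share, then the
      pieces could not cover \<open>F\<close>, since \<open>F'\<close> has strictly less than its
      share.\<close>
    have "\<exists>J\<in>W. card F < Suc ?w * card (D J)"
    proof (rule ccontr)
      assume "\<not> ?thesis"
      then have small: "\<forall>J\<in>W. Suc ?w * card (D J) \<le> card F"
        by (auto simp: not_less)
      have fin: "finite F'" "\<And>J. J \<in> W \<Longrightarrow> finite (D J)"
        using * less.prems(1) finite_subset by blast+
      have "card F \<le> card (F' \<union> (\<Union>J\<in>W. D J))"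
        using * fin less.prems(3) by (intro card_mono) auto
      also have "\<dots> \<le> card F' + (\<Sum>J\<in>W. card (D J))"
        using card_Un_le[of F' "\<Union>J\<in>W. D J"] card_UN_le[OF less.prems(3), of D] by linarith
      finally have "Suc ?w * card F \<le> Suc ?w * card F' + (\<Sum>J\<in>W. Suc ?w * card (D J))"
        by (metis mult_le_mono2 distrib_left sum_distrib_left)
      also have "\<dots> < card F + ?w * card F"
        using False sum_bounded_above[of W "\<lambda>J. Suc ?w * card (D J)" "card F"] small by simp
      finally show False
        by simp
    qed
    then obtain J where J: "J \<in> W" "card F < Suc ?w * card (D J)"
      by auto
    let ?W = "W - {J}"
    have "card ?W < ?w"
      using J(1) less.prems(3) by (metis card_Diff1_less)
    moreover have "finite (D J)" "finite ?W"
      using *(3) J(1) less.prems(1,3) by (auto intro: rev_finite_subset[of F])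
    moreover have "petals s (D J) \<subseteq> ?W"
      using * J less.prems(4) petals_mono[of "D J" F s] by blast
    ultimately obtain G where G: "G \<subseteq> D J" "homogeneous s (petals s G) G"
      "card (D J) \<le> Suc (card ?W) ^ Suc (card ?W) * card G"
      using less.hyps[of ?W "D J"] less.prems(2) by blast
    have "Suc (card ?W) = ?w"
      using J(1) less.prems(3) by (metis card_Suc_Diff1)
    have "card F \<le> Suc ?w * (?w ^ ?w * card G)"
      using J(2) G(3) unfolding \<open>Suc (card ?W) = ?w\<close> by (meson less_imp_le mult_le_mono2 order_trans)
    also have "\<dots> \<le> Suc ?w * (Suc ?w ^ ?w * card G)"
      by (intro mult_left_mono mult_right_mono power_mono) auto
    finally have "card F \<le> Suc ?w ^ Suc ?w * card G"
      by (simp only: power_Suc mult.assoc)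
    moreover have "G \<subseteq> F"
      using G(1) *(3) J(1) by blast
    ultimately show ?thesis
      using G(2) by (intro exI[of _ G] conjI)
  qed
qed

text \<open>In a \<open>J\<close>-sunflower through \<open>y\<close>, the members take distinct
  values at each \<open>c\<close> in \<open>J\<close>, so at most \<open>card J\<close> of them meet
  \<open>x\<close> somewhere on \<open>J\<close>. Discarding these and \<open>y\<close> leaves a
  member because \<open>s \<ge> card J + 2\<close>.\<close>

lemma homogeneous_step:
  assumes "homogeneous s W F" "J \<in> W" "y \<in> F" "finite J" "s \<ge> card J + 2"
  shows "\<exists>z\<in>F. differ y z = J \<and> (\<forall>c\<in>J. z c \<noteq> x c)"
proof -
  obtain Y where Y: "Y \<subseteq> F" "y \<in> Y" "card Y = s" "sunflower J Y"
    using assms unfolding homogeneous_def by blast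
  have fin: "finite Y"
    using Y(3) assms(5) by (auto intro: card_ge_0_finite)
  define B where "B c = {z \<in> Y. z c = x c}" for c
  have "card (B c) \<le> 1" if "c \<in> J" for c
  proof -
    have "z = z'" if "z \<in> B c" "z' \<in> B c" for z z'
      using that Y(4) \<open>c \<in> J\<close> unfolding B_def sunflower_def differ_def by force
    then show ?thesis
      using fin card_le_Suc0_iff_eq[of "B c"] by (auto simp: B_def)
  qed
  then have "card (\<Union>c\<in>J. B c) \<le> card J * 1"
    using assms(4) by (intro card_UN_bound)
  moreover have "finite (\<Union>c\<in>J. B c)"
    using assms(4) fin by (auto simp: B_def)
  ultimately have "card (insert y (\<Union>c\<in>J. B c)) < card Y"
    using Y(3) assms(5) by (simp add: card_insert_if)
  then have "\<not> Y \<subseteq> insert y (\<Union>c\<in>J. B c)"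
    using \<open>finite (\<Union>c\<in>J. B c)\<close> by (meson card_mono finite.insertI not_less)
  then obtain z where "z \<in> Y" "z \<noteq> y" "\<forall>c\<in>J. z \<notin> B c"
    by blast
  then show ?thesis
    using Y unfolding B_def sunflower_def by (intro bexI[of _ z]) auto
qed

text \<open>The sets of \<open>\<J>\<close> are added one at a time. Where a new \<open>J\<close>
  overlaps earlier ones, a change could restore the value of \<open>x\<close>;
  \<open>homogeneous_step\<close> avoids this by keeping \<open>z\<close> different from
  \<open>x\<close> on all of \<open>J\<close>.\<close>

lemma homogeneous_Union:
  assumes "homogeneous s W F" "finite \<J>" "\<J> \<subseteq> W" "x \<in> F"
    and "\<And>J. J \<in> \<J> \<Longrightarrow> finite J \<and> s \<ge> card J + 2"
  shows "\<exists>y\<in>F. differ x y = \<Union>\<J>"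
  using assms(2,3,5)
proof (induction \<J> rule: finite_induct)
  case empty
  then show ?case
    using assms(4) by (intro bexI[of _ x]) auto
next
  case (insert J \<J>)
  then obtain y where y: "y \<in> F" "differ x y = \<Union>\<J>"
    by auto
  then obtain z where z: "z \<in> F" "differ y z = J" "\<forall>c\<in>J. z c \<noteq> x c"
    using homogeneous_step[OF assms(1) _ y(1), of J x] insert.prems by auto
  have "differ x z = \<Union>(insert J \<J>)"
  proof (rule Set.set_eqI)
    fix c
    show "c \<in> differ x z \<longleftrightarrow> c \<in> \<Union>(insert J \<J>)"
    proof (cases "c \<in> J")
      case True
      then show ?thesis
        using z(3) by (auto simp: differ_def)
    next
      case False
      then have "z c = y c"
        using z(2) by (auto simp: differ_def)
      then have "c \<in> differ x z \<longleftrightarrow> c \<in> differ x y"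
        by (simp add: differ_def)
      then show ?thesis
        using y(2) False by simp
    qed
  qed
  then show ?case
    using z(1) by blast
qed

section \<open>Ramsey's theorem and the Hamming distance bound\<close>

text \<open>One set \<open>H\<close> serves all sizes \<open>j \<le> t\<close> simultaneously.
  Ramsey's theorem for size \<open>t + 1\<close> gives a homogeneous set \<open>G\<close> of
  \<open>N\<close> points, and the induction hypothesis is applied inside \<open>G\<close> after
  numbering its points by \<open>h\<close>.\<close>

lemma ramsey_up_to:
  "\<exists>N. \<forall>P. \<exists>H\<subseteq>{..<N::nat}. card H = m \<and>
     (\<forall>j\<le>t. (\<forall>U\<in>nsets H j. P U) \<or> (\<forall>U\<in>nsets H j. \<not> P U))"
proof (induction t)
  case 0
  show ?case
    by (intro exI[of _ m] allI exI[of _ "{..<m}"]) (auto simp: nsets_def)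
next
  case (Suc t)
  then obtain N where N: "\<And>P. \<exists>H\<subseteq>{..<N::nat}. card H = m \<and>
     (\<forall>j\<le>t. (\<forall>U\<in>nsets H j. P U) \<or> (\<forall>U\<in>nsets H j. \<not> P U))"
    by metis
  obtain R where R: "partn_lst {..<R::nat} [N, N] (Suc t)"
    using ramsey_full by blast
  show ?case
  proof (intro exI[of _ R] allI)
    fix P :: "nat set \<Rightarrow> bool"
    obtain i G where G: "i < length [N, N]" "G \<in> nsets {..<R} ([N, N] ! i)"
      "(\<lambda>U. if P U then 0 else 1::nat) ` nsets G (Suc t) \<subseteq> {i}"
      by (rule partn_lstE[OF R, of "\<lambda>U. if P U then 0 else 1" 2]) auto
    have "[N, N] ! i = N"
      using G(1) by (auto simp: less_Suc_eq)
    then have G': "G \<subseteq> {..<R}" "finite G" "card G = N"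
      using G(2) by (auto simp: nsets_def)
    have mono: "(\<forall>U\<in>nsets G (Suc t). P U) \<or> (\<forall>U\<in>nsets G (Suc t). \<not> P U)"
    proof (cases "i = 0")
      case True
      then have "\<forall>U\<in>nsets G (Suc t). P U"
        using G(3) by (auto simp: image_subset_iff split: if_splits)
      then show ?thesis ..
    next
      case False
      then have "\<forall>U\<in>nsets G (Suc t). \<not> P U"
        using G(3) by (auto simp: image_subset_iff split: if_splits)
      then show ?thesis ..
    qed
    obtain h where h: "bij_betw h {..<N} G"
      using ex_bij_betw_nat_finite[OF G'(2)] G'(3) by (auto simp: atLeast0LessThan)
    obtain H where H: "H \<subseteq> {..<N}" "card H = m"
      "\<forall>j\<le>t. (\<forall>U\<in>nsets H j. P (h ` U)) \<or> (\<forall>U\<in>nsets H j. \<not> P (h ` U))"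
      using N[of "\<lambda>U. P (h ` U)"] by auto
    have inj: "inj_on h H"
      using h H(1) by (meson bij_betw_def inj_on_subset)
    have nsets: "nsets (h ` H) j \<subseteq> (`) h ` nsets H j" for j
    proof
      fix U assume "U \<in> nsets (h ` H) j"
      then obtain Z where "Z \<subseteq> H" "U = h ` Z" "card U = j" "finite U"
        unfolding nsets_def by (auto simp: subset_image_iff)
      moreover have "finite Z" "card Z = j"
        using calculation inj by (metis finite_image_iff inj_on_subset, metis card_image inj_on_subset)
      ultimately show "U \<in> (`) h ` nsets H j"
        by (auto simp: nsets_def)
    qed
    have sub: "h ` H \<subseteq> G"
      using h H(1) by (auto simp: bij_betw_def)
    have "(\<forall>U\<in>nsets (h ` H) j. P U) \<or> (\<forall>U\<in>nsets (h ` H) j. \<not> P U)" if "j \<le> Suc t" for j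
    proof (cases "j = Suc t")
      case True
      then show ?thesis
        using mono nsets_mono[OF sub, of j] by blast
    next
      case False
      then have "j \<le> t"
        using that by simp
      then show ?thesis
        using H(3) nsets[of j] by fastforce
    qed
    then show "\<exists>H\<subseteq>{..<R}. card H = m \<and>
       (\<forall>j\<le>Suc t. (\<forall>U\<in>nsets H j. P U) \<or> (\<forall>U\<in>nsets H j. \<not> P U))"
      using H(2) sub G'(1) card_image[OF inj] by (intro exI[of _ "h ` H"]) auto
  qed
qed

lemma fibre_large:
  assumes "finite F" "finite B" "f ` F \<subseteq> B" "card B * b < card F"
  shows "\<exists>z. b < card {x \<in> F. f x = z}"
proof (rule ccontr)
  assume "\<not> ?thesis"
  then have "card (\<Union>z\<in>B. {x \<in> F. f x = z}) \<le> card B * b"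
    using assms(2) by (intro card_UN_bound) (auto simp: not_less)
  moreover have "F = (\<Union>z\<in>B. {x \<in> F. f x = z})"
    using assms(3) by auto
  ultimately show False
    using assms(4) by simp
qed

text \<open>Ramsey's theorem fixes \<open>r\<close> in terms of \<open>k\<close>. The constant
  \<open>C\<close> is \<open>a * b\<close>, with \<open>b\<close> the sunflower threshold for
  \<open>k\<close> coordinates and \<open>a\<close> the loss in passing to a homogeneous subfamily;
  neither depends on \<open>M\<close>.\<close>

lemma hamming_distance_unavoidable:
  assumes "k > 0"
  shows "\<exists>r C. r \<ge> k \<and> (\<forall>M. \<forall>F \<subseteq> {..<r} \<rightarrow>\<^sub>E {..<M::nat}.
           card F > C * M ^ (r - k) \<longrightarrow> (\<exists>x\<in>F. \<exists>y\<in>F. card (differ x y) = k))"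
proof -
  obtain r where r: "\<And>P. \<exists>H\<subseteq>{..<r::nat}. card H = k \<and>
     (\<forall>j\<le>k. (\<forall>U\<in>nsets H j. P U) \<or> (\<forall>U\<in>nsets H j. \<not> P U))"
    using ramsey_up_to by metis
  have "r \<ge> k"
    using r[of "\<lambda>_. True"] by (metis card_lessThan card_mono finite_lessThan)
  \<comment> \<open>Large enough for \<open>homogeneous_Union\<close> with any set of coordinates as
    petal set.\<close>
  define s where "s = r + 2"
  obtain b where "\<forall>(I :: nat set) S :: (nat \<Rightarrow> nat) set. finite I \<longrightarrow> card I = k \<longrightarrow> finite S \<longrightarrow>
     (\<forall>x\<in>S. \<forall>y\<in>S. differ x y \<subseteq> I) \<longrightarrow> card S > b \<longrightarrow>
     (\<exists>J Y. J \<subseteq> I \<and> Y \<subseteq> S \<and> card Y = s \<and> sunflower J Y)"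
    using sunflower_exists[of k s] ..
  note b = this[rule_format]
  define a where "a = Suc (card (Pow {..<r})) ^ Suc (card (Pow {..<r}))"
  show ?thesis
  proof (rule exI[of _ r], rule exI[of _ "a * b"], intro conjI allI impI)
    show "r \<ge> k" by fact
    fix M F assume F: "F \<subseteq> {..<r} \<rightarrow>\<^sub>E {..<M::nat}" and big: "a * b * M ^ (r - k) < card F"
    have fin: "finite F"
      using F by (rule finite_subset) (auto intro: finite_PiE)
    have differ_sub: "differ x y \<subseteq> {..<r}" if "x \<in> F" "y \<in> F" for x y
      using differ_subset_PiE[of x _ _ y] that F by blast
    \<comment> \<open>The empty set is excluded because \<open>s \<ge> 2\<close> provides two
      distinct members; otherwise a union of petal sets could be empty.\<close>
    have petals: "petals s G \<subseteq> Pow {..<r} - {{}}" if "G \<subseteq> F" for G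
    proof
      fix J assume "J \<in> petals s G"
      then obtain Y where Y: "Y \<subseteq> G" "card Y = s" "sunflower J Y"
        by (auto simp: petals_def)
      have "\<not> card Y \<le> Suc 0" "finite Y"
        using Y(2) by (auto simp: s_def intro: card_ge_0_finite)
      then obtain x y where "x \<in> Y" "y \<in> Y" "x \<noteq> y"
        by (auto simp: card_le_Suc0_iff_eq)
      then have "differ x y = J" "x \<in> F" "y \<in> F"
        using Y that by (auto simp: sunflower_def)
      then show "J \<in> Pow {..<r} - {{}}"
        using differ_sub \<open>x \<noteq> y\<close> by (metis differ_eq_empty_iff Diff_iff Pow_iff empty_iff insert_iff)
    qed
    obtain G where G: "G \<subseteq> F" "homogeneous s (petals s G) G" "card F \<le> a * card G"
      using homogeneous_subfamily[OF fin, of s "Pow {..<r}"] petals[of F]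
      by (auto simp: s_def a_def)
    have "a * (b * M ^ (r - k)) < a * card G"
      using less_le_trans[OF big G(3)] by (simp only: mult.assoc)
    then have bigG: "b * M ^ (r - k) < card G"
      by simp
    have finG: "finite G"
      using G(1) fin finite_subset by blast
    \<comment> \<open>There are \<open>M ^ (r - k)\<close> ways to fix the values outside
      \<open>I\<close>, so some choice is shared by more than \<open>b\<close> members of
      \<open>G\<close>. These differ only inside \<open>I\<close> and contain a sunflower.\<close>
    have covered: "\<exists>J\<in>petals s G. J \<subseteq> I" if I: "I \<subseteq> {..<r}" "card I = k" for I
    proof -
      have finI: "finite I"
        using I(1) finite_subset by blast
      define f where "f x = restrict x ({..<r} - I)" for x :: "nat \<Rightarrow> nat"
      let ?B = "({..<r} - I) \<rightarrow>\<^sub>E {..<M}"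
      have "f ` G \<subseteq> ?B"
        using F G(1) unfolding f_def by fastforce
      moreover have "card ?B = M ^ (r - k)"
        using I finI by (simp add: card_PiE card_Diff_subset)
      ultimately obtain z where z: "b < card {x \<in> G. f x = z}"
        using fibre_large[OF finG, of ?B f b] bigG by (auto simp: finite_PiE mult.commute)
      have "differ x y \<subseteq> I" if "x \<in> G" "y \<in> G" "f x = f y" for x y
      proof
        fix c assume c: "c \<in> differ x y"
        then have "c \<in> {..<r}"
          using differ_sub that G(1) by blast
        then show "c \<in> I"
          using c fun_cong[OF that(3), of c] by (auto simp: f_def differ_def restrict_def split: if_splits)
      qed
      then obtain J Y where "J \<subseteq> I" "Y \<subseteq> {x \<in> G. f x = z}" "card Y = s" "sunflower J Y"
        using b[OF finI I(2), of "{x \<in> G. f x = z}"] finG z by auto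
      then show ?thesis
        unfolding petals_def by blast
    qed
    obtain H where H: "H \<subseteq> {..<r}" "card H = k"
      "\<forall>j\<le>k. (\<forall>U\<in>nsets H j. U \<in> petals s G) \<or> (\<forall>U\<in>nsets H j. U \<notin> petals s G)"
      using r[of "\<lambda>U. U \<in> petals s G"] by auto
    have finH: "finite H"
      using H(1) finite_subset by blast
    obtain J where J: "J \<in> petals s G" "J \<subseteq> H"
      using covered H by blast
    have "J \<noteq> {}"
      using petals[OF G(1)] J(1) by blast
    have "finite J" "card J \<le> k"
      using J(2) finH H(2) finite_subset card_mono by blast+
    then have all: "nsets H (card J) \<subseteq> petals s G"
      using H(3) J by (auto simp: nsets_def)
    \<comment> \<open>One petal set inside \<open>H\<close> makes all subsets of \<open>H\<close> of
      its size petal sets, and as \<open>J\<close> is nonempty they cover \<open>H\<close>.\<close>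
    have "\<Union>(nsets H (card J)) = H"
    proof
      show "\<Union>(nsets H (card J)) \<subseteq> H"
        by (auto simp: nsets_def)
      show "H \<subseteq> \<Union>(nsets H (card J))"
      proof
        fix c assume c: "c \<in> H"
        obtain d where d: "d \<in> J"
          using \<open>J \<noteq> {}\<close> by auto
        \<comment> \<open>Exchanging \<open>d\<close> for \<open>c\<close> keeps the size.\<close>
        have "(if c \<in> J then J else insert c (J - {d})) \<in> nsets H (card J)"
          using c d J(2) \<open>finite J\<close> card_Suc_Diff1[of J d] by (auto simp: nsets_def card_insert_if)
        then show "c \<in> \<Union>(nsets H (card J))"
          by (rule UnionI) auto
      qed
    qed
    moreover have "finite (nsets H (card J))"
      using finH by (rule finite_imp_finite_nsets)
    moreover obtain x where x: "x \<in> G"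
      using bigG by (metis card.empty equals0I not_less_zero)
    moreover have "finite K \<and> s \<ge> card K + 2" if "K \<in> nsets H (card J)" for K
      using that \<open>card J \<le> k\<close> \<open>r \<ge> k\<close> by (auto simp: nsets_def s_def)
    ultimately obtain y where "y \<in> G" "differ x y = H"
      using homogeneous_Union[OF G(2) _ all x] by metis
    then show "\<exists>x\<in>F. \<exists>y\<in>F. card (differ x y) = k"
      using x G(1) H(2) by blast
  qed
qed

section \<open>Power sums in characteristic 2\<close>

lemma CHAR_bit [simp]: "CHAR(bit) = 2"
proof -
  have "CHAR(bit) dvd 2"
    by (subst of_nat_eq_0_iff_char_dvd[symmetric]) simp
  then have "CHAR(bit) = 1 \<or> CHAR(bit) = 2"
    by (metis two_is_prime_nat prime_nat_iff)
  then show ?thesis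
    using CHAR_not_1[where 'a = bit] by auto
qed

section \<open>The field with \<open>2 ^ m\<close> elements\<close>

text \<open>For \<open>m > 0\<close> this is GF(2^m), taken as a subset of the algebraic closure of
  GF(2), so that \<open>m\<close> may vary with \<open>n\<close> inside a single type.\<close>

definition GF_set :: "nat \<Rightarrow> bit alg_closure set" where
  "GF_set m = {x. x ^ (2 ^ m) = x}"

lemma add_self_char2: "x + x = 0" for x :: "bit alg_closure"
proof -
  have "of_nat 2 = (0 :: bit alg_closure)"
    by (subst of_nat_eq_0_iff_char_dvd) simp
  then show ?thesis
    by (simp flip: mult_2)
qed

text \<open>Over an algebraically closed field \<open>p\<close> splits into \<open>degree p\<close>
  linear factors, and a repeated factor would give a common root of \<open>p\<close> and
  \<open>pderiv p\<close>.\<close>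

lemma card_roots_separable:
  fixes p :: "'a :: alg_closed_field poly"
  assumes "p \<noteq> 0" and "\<And>x. poly p x = 0 \<Longrightarrow> poly (pderiv p) x \<noteq> 0"
  shows "card {x. poly p x = 0} = degree p"
proof -
  obtain A where A: "size A = degree p" "p = smult (lead_coeff p) (\<Prod>x\<in>#A. [:-x, 1:])"
    using alg_closed_imp_factorization[OF assms(1)] by blast
  have roots: "{x. poly p x = 0} = set_mset A"
    using assms(1) by (subst A(2)) (auto simp: poly_prod_mset image_iff)
  have le: "count A x \<le> 1" for x
  proof (rule ccontr)
    assume "\<not> count A x \<le> 1"
    then have x: "x \<in># A" "x \<in># A - {#x#}"
      by (auto simp flip: count_greater_zero_iff)
    then obtain B where B: "A = add_mset x (add_mset x B)"
      by (metis insert_DiffM)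
    define q where "q = smult (lead_coeff p) (\<Prod>y\<in>#B. [:-y, 1:])"
    have "p = [:-x, 1:] * ([:-x, 1:] * q)"
      by (subst A(2)) (simp add: B q_def)
    then have "poly p x = 0" "poly (pderiv p) x = 0"
      by (simp_all only: pderiv_mult poly_mult poly_add) simp_all
    then show False
      using assms(2) by blast
  qed
  have count: "count A x = (if x \<in># A then 1 else 0)" for x
    using le[of x] count_greater_zero_iff[of A x]
    by (auto simp del: count_greater_zero_iff simp: not_in_iff)
  have "A = mset_set (set_mset A)"
  proof (rule multiset_eqI)
    show "count A x = count (mset_set (set_mset A)) x" for x
      unfolding count[of x] count_mset_set' by simp
  qed
  then show ?thesis
    unfolding roots A(1)[symmetric] using size_mset_set[of "set_mset A"] by argo
qed

text \<open>In characteristic 2 the derivative of \<open>X^(2^m) - X\<close> is the constant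
  \<open>-1\<close>, so all \<open>2 ^ m\<close> roots are distinct.\<close>

lemma card_GF_set:
  assumes "m > 0"
  shows "card (GF_set m) = 2 ^ m"
proof -
  let ?p = "monom 1 (2 ^ m) - [:0, 1:] :: bit alg_closure poly"
  have deg: "degree ?p = 2 ^ m"
  proof -
    have "degree [:0, - 1 :: bit alg_closure:] < degree (monom (1 :: bit alg_closure) (2 ^ m))"
      using assms one_less_power[of "2 :: nat" m] by (simp add: degree_monom_eq)
    then have "degree (monom 1 (2 ^ m) + [:0, - 1 :: bit alg_closure:]) = 2 ^ m"
      by (subst degree_add_eq_left) (auto simp: degree_monom_eq)
    moreover have "monom 1 (2 ^ m) + [:0, - 1 :: bit alg_closure:] = ?p"
      by (simp add: diff_conv_add_uminus del: add_uminus_conv_diff)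
    ultimately show ?thesis
      by simp
  qed
  then have "?p \<noteq> 0"
    by auto
  have "of_nat (2 ^ m) = (0 :: bit alg_closure)"
    using assms by (subst of_nat_eq_0_iff_char_dvd) auto
  then have "pderiv ?p = [:-1:]"
    unfolding pderiv_diff pderiv_monom by (simp add: pderiv_pCons del: of_nat_power)
  then have "card {x. poly ?p x = 0} = degree ?p"
    using \<open>?p \<noteq> 0\<close> by (intro card_roots_separable) auto
  also have "{x. poly ?p x = 0} = GF_set m"
    by (auto simp: GF_set_def poly_monom)
  finally show ?thesis
    by (simp only: deg)
qed

lemma GF_set_add: "x \<in> GF_set m \<Longrightarrow> y \<in> GF_set m \<Longrightarrow> x + y \<in> GF_set m"
  unfolding GF_set_def by (simp add: freshmans_dream'[where n = m])

lemma GF_set_0: "0 \<in> GF_set m"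
  by (simp add: GF_set_def)

lemma GF_set_power: "x \<in> GF_set m \<Longrightarrow> x ^ j \<in> GF_set m"
  unfolding GF_set_def by (simp flip: power_mult add: mult.commute[of j]) (simp add: power_mult)

lemma GF_set_sum: "(\<And>x. x \<in> A \<Longrightarrow> f x \<in> GF_set m) \<Longrightarrow> sum f A \<in> GF_set m"
  by (induction A rule: infinite_finite_induct) (auto intro: GF_set_0 GF_set_add)

section \<open>Nonvanishing power sums\<close>

text \<open>Lagrange interpolation: a polynomial of degree \<open>card D - 1\<close> that vanishes
  on \<open>D\<close> except at \<open>a\<close> has nonzero sum over \<open>D\<close>, yet this sum
  is a linear combination of the power sums.\<close>

lemma power_sums_nonzero:
  fixes D :: "'a :: field set"
  assumes "finite D" "D \<noteq> {}"
  shows "\<exists>i < card D. (\<Sum>x\<in>D. x ^ i) \<noteq> 0"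
proof (rule ccontr)
  assume "\<not> ?thesis"
  then have zero: "(\<Sum>x\<in>D. x ^ i) = 0" if "i < card D" for i
    using that by auto
  obtain a where a: "a \<in> D"
    using assms by auto
  define f where "f = (\<Prod>y\<in>D - {a}. [:-y, 1:])"
  have "degree f = card (D - {a})"
    unfolding f_def by (subst degree_prod_eq_sum_degree) auto
  then have deg: "degree f < card D"
    using card_Diff1_less[OF assms(1) a] by simp
  have "(\<Sum>x\<in>D. poly f x) = (\<Sum>i\<le>degree f. coeff f i * (\<Sum>x\<in>D. x ^ i))"
    unfolding poly_altdef sum_distrib_left by (rule sum.swap)
  also have "\<dots> = 0"
    using zero deg by (intro sum.neutral) auto
  finally have "(\<Sum>x\<in>D. poly f x) = 0" .
  moreover have "(\<Sum>x\<in>D. poly f x) = (\<Sum>x\<in>{a}. poly f x)"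
    using a assms(1) by (intro sum.mono_neutral_right) (auto simp: f_def poly_prod)
  moreover have "poly f a \<noteq> 0"
    using assms(1) by (auto simp: f_def poly_prod)
  ultimately show False
    by simp
qed

text \<open>In characteristic 2 the even power sums are squares of power sums of half the exponent.\<close>

lemma odd_power_sums_nonzero:
  fixes D :: "bit alg_closure set"
  assumes "card D = 2 * k" "k > 0"
  shows "\<exists>j < k. (\<Sum>x\<in>D. x ^ (2 * j + 1)) \<noteq> 0"
proof (rule ccontr)
  assume "\<not> ?thesis"
  then have odd: "(\<Sum>x\<in>D. x ^ (2 * j + 1)) = 0" if "j < k" for j
    using that by auto
  have "(\<Sum>x\<in>D. x ^ i) = 0" if "i < 2 * k" for i
    using that
  proof (induction i rule: less_induct)
    case (less i)
    consider "i = 0" | "odd i" | "i > 0" "even i"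
      by auto
    then show ?case
    proof cases
      case 1
      \<comment> \<open>The power sum of exponent 0 is \<open>card D\<close>, which vanishes in
        characteristic 2 because it is even.\<close>
      then show ?thesis
        using assms by (simp add: of_nat_eq_0_iff_char_dvd del: of_nat_mult)
    next
      case 2
      then show ?thesis
        using odd less.prems by (elim oddE) auto
    next
      case 3
      then obtain h where h: "i = h * 2" "h < i"
        by (elim evenE) auto
      have "(\<Sum>x\<in>D. x ^ i) = (\<Sum>x\<in>D. x ^ h) ^ 2"
        unfolding h(1) power_mult by (rule freshmans_dream_sum[symmetric]) auto
      then show ?thesis
        using less h by simp
    qed
  qed
  moreover have "finite D" "D \<noteq> {}"
    using assms by (auto intro: card_ge_0_finite)
  ultimately show False
    using power_sums_nonzero[of D] assms(1) by auto
qed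

section \<open>Copies of a graph\<close>

text \<open>The injection runs out of \<open>H\<close>, so that neither an ambient vertex set nor
  isolated vertices have to be mentioned.\<close>

definition copy_of :: "'a graph \<Rightarrow> 'b set set \<Rightarrow> bool" where
  "copy_of H D \<longleftrightarrow> (\<exists>g. inj_on g (verts H) \<and> D = (`) g ` edges H)"

lemma graph_iso_iff:
  assumes "simple_graph G" "simple_graph H"
  shows "graph_iso G H \<longleftrightarrow> (\<exists>f. bij_betw f (verts G) (verts H) \<and> edges H = (`) f ` edges G)"
proof -
  have "(\<forall>u\<in>verts G. \<forall>v\<in>verts G. {u, v} \<in> edges G \<longleftrightarrow> {f u, f v} \<in> edges H) \<longleftrightarrow>
      edges H = (`) f ` edges G" (is "?P \<longleftrightarrow> ?Q") if f: "bij_betw f (verts G) (verts H)" for f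
  proof
    assume P: ?P
    show ?Q
    proof
      show "edges H \<subseteq> (`) f ` edges G"
      proof
        fix e assume e: "e \<in> edges H"
        then have "card e = 2" "e \<subseteq> verts H"
          using assms(2) by (auto simp: simple_graph_def)
        then obtain a b where ab: "e = {a, b}" "a \<in> verts H" "b \<in> verts H"
          by (auto simp: card_2_iff)
        then obtain u v where "u \<in> verts G" "v \<in> verts G" "a = f u" "b = f v"
          using f by (metis bij_betw_imp_surj_on imageE)
        then show "e \<in> (`) f ` edges G"
          using P e ab by (intro image_eqI[of _ _ "{u, v}"]) auto
      qed
      show "(`) f ` edges G \<subseteq> edges H"
      proof
        fix e assume "e \<in> (`) f ` edges G"
        then obtain e' where e': "e' \<in> edges G" "e = f ` e'"
          by auto
        then have "card e' = 2" "e' \<subseteq> verts G"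
          using assms(1) by (auto simp: simple_graph_def)
        then obtain u v where "e' = {u, v}" "u \<in> verts G" "v \<in> verts G"
          by (auto simp: card_2_iff)
        then show "e \<in> edges H"
          using P e' by auto
      qed
    qed
  next
    assume Q: ?Q
    show ?P
    proof (intro ballI)
      fix u v assume uv: "u \<in> verts G" "v \<in> verts G"
      have "{u, v} \<in> edges G" if "{f u, f v} \<in> edges H"
      proof -
        have "f ` {u, v} \<in> (`) f ` edges G"
          using that unfolding Q by simp
        then obtain e where e: "e \<in> edges G" "f ` {u, v} = f ` e"
          by blast
        moreover have "e \<subseteq> verts G"
          using e(1) assms(1) by (auto simp: simple_graph_def)
        ultimately have "{u, v} = e"
          using uv f inj_on_image_eq_iff[of f "verts G" "{u, v}" e] by (auto simp: bij_betw_def)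
        then show ?thesis
          using e by simp
      qed
      moreover have "{f u, f v} \<in> edges H" if "{u, v} \<in> edges G"
      proof -
        have "f ` {u, v} \<in> (`) f ` edges G"
          using that by (rule imageI)
        then show ?thesis
          using Q by simp
      qed
      ultimately show "{u, v} \<in> edges G \<longleftrightarrow> {f u, f v} \<in> edges H"
        by blast
    qed
  qed
  then show ?thesis
    unfolding graph_iso_def by (intro ex_cong1 conj_cong refl)
qed

lemma drop_isolated_eq: "simple_graph G \<Longrightarrow> drop_isolated G = (\<Union>(edges G), edges G)"
  by (cases G) (auto simp: drop_isolated_def simple_graph_def)

text \<open>An isomorphism onto \<open>H\<close> and an embedding of \<open>H\<close> are inverse to
  each other: since \<open>H\<close> has no isolated vertices, the vertices covered by
  \<open>D\<close> are exactly the image of \<open>verts H\<close>.\<close>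

lemma graph_iso_drop_isolated_iff:
  assumes "simple_graph (V, D)" "simple_graph H" "\<Union>(edges H) = verts H"
  shows "graph_iso (drop_isolated (V, D)) (drop_isolated H) \<longleftrightarrow> copy_of H D"
proof -
  have G: "drop_isolated (V, D) = (\<Union>D, D)" and H: "drop_isolated H = H"
    using assms by (simp_all add: drop_isolated_eq prod_eq_iff)
  have "graph_iso (\<Union>D, D) H \<longleftrightarrow> (\<exists>f. bij_betw f (\<Union>D) (verts H) \<and> edges H = (`) f ` D)"
    using assms by (subst graph_iso_iff) (auto simp: simple_graph_def)
  also have "\<dots> \<longleftrightarrow> copy_of H D"
  proof
    assume "\<exists>f. bij_betw f (\<Union>D) (verts H) \<and> edges H = (`) f ` D"
    then obtain f where f: "bij_betw f (\<Union>D) (verts H)" "edges H = (`) f ` D"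
      by blast
    let ?g = "inv_into (\<Union>D) f"
    have "?g ` f ` e = e" if "e \<in> D" for e
      using that f(1) by (intro inv_into_image_cancel) (auto simp: bij_betw_def)
    then have "D = (`) ?g ` edges H"
      unfolding f(2) image_image by simp
    moreover have "inj_on ?g (verts H)"
      using bij_betw_inv_into[OF f(1)] by (simp add: bij_betw_def)
    ultimately show "copy_of H D"
      unfolding copy_of_def by blast
  next
    assume "copy_of H D"
    then obtain g where g: "inj_on g (verts H)" "D = (`) g ` edges H"
      by (auto simp: copy_of_def)
    let ?f = "inv_into (verts H) g"
    have "\<Union>D = g ` verts H"
      unfolding g(2) assms(3)[symmetric] by auto
    then have "bij_betw ?f (\<Union>D) (verts H)"
      using g(1) by (simp add: bij_betw_imageI bij_betw_inv_into)
    moreover have "?f ` g ` e = e" if "e \<in> edges H" for e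
      using that g(1) assms(3) by (intro inv_into_image_cancel) auto
    then have "edges H = (`) ?f ` D"
      unfolding g(2) image_image by simp
    ultimately show "\<exists>f. bij_betw f (\<Union>D) (verts H) \<and> edges H = (`) f ` D"
      by blast
  qed
  finally show ?thesis
    unfolding G H .
qed

section \<open>Copies of stars and matchings\<close>

lemma edges_star: "edges (star t) = (\<lambda>i. {0, i}) ` {1..t}"
  unfolding star_def by auto

lemma edges_matching: "edges (matching t) = (\<lambda>i. {2 * i, 2 * i + 1}) ` {..<t}"
  unfolding matching_def by auto

lemma simple_graph_star: "simple_graph (star t)"
  by (auto simp: simple_graph_def star_def card_insert_if)

lemma Union_edges_star:
  assumes "t > 0"
  shows "\<Union>(edges (star t)) = verts (star t)"
proof -
  have U: "\<Union>((\<lambda>i. {0, i}) ` {1..t}) = {0..t}"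
  proof (intro Set.set_eqI iffI)
    fix v assume "v \<in> {0..t}"
    \<comment> \<open>A leaf lies on its own edge, and the centre 0 on the edge to leaf 1.\<close>
    then have "v \<in> {0, max 1 v}" "max 1 v \<in> {1..t}"
      using assms by auto
    then show "v \<in> \<Union>((\<lambda>i. {0, i}) ` {1..t})"
      by blast
  qed (auto split: if_splits)
  show ?thesis
    unfolding edges_star U by (simp add: star_def)
qed

lemma simple_graph_matching: "simple_graph (matching t)"
  by (auto simp: simple_graph_def matching_def card_insert_if)

lemma Union_edges_matching: "\<Union>(edges (matching t)) = verts (matching t)"
proof
  show "\<Union>(edges (matching t)) \<subseteq> verts (matching t)"
    by (auto simp: matching_def)
  show "verts (matching t) \<subseteq> \<Union>(edges (matching t))"
  proof
    fix v assume "v \<in> verts (matching t)"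
    then have "v div 2 < t" "v \<in> {2 * (v div 2), 2 * (v div 2) + 1}"
      by (auto simp: matching_def)
    then show "v \<in> \<Union>(edges (matching t))"
      unfolding matching_def snd_conv by blast
  qed
qed

lemma copy_of_star_iff:
  "copy_of (star t) D \<longleftrightarrow> (\<exists>v L. v \<notin> L \<and> finite L \<and> card L = t \<and> D = (\<lambda>u. {v, u}) ` L)"
proof
  assume "copy_of (star t) D"
  then obtain g where g: "inj_on g {0..t}" "D = (`) g ` (\<lambda>i. {0, i}) ` {1..t}"
    unfolding copy_of_def edges_star by (auto simp: star_def)
  have "D = (\<lambda>u. {g 0, u}) ` g ` {1..t}"
    unfolding g(2) by (simp add: image_image)
  moreover have "card (g ` {1..t}) = t"
    using inj_on_subset[OF g(1), of "{1..t}"] by (simp add: card_image)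
  moreover have "g 0 \<notin> g ` {1..t}"
    using inj_onD[OF g(1), of 0] by fastforce
  ultimately show "\<exists>v L. v \<notin> L \<and> finite L \<and> card L = t \<and> D = (\<lambda>u. {v, u}) ` L"
    by blast
next
  assume "\<exists>v L. v \<notin> L \<and> finite L \<and> card L = t \<and> D = (\<lambda>u. {v, u}) ` L"
  then obtain v L where L: "v \<notin> L" "finite L" "card L = t" "D = (\<lambda>u. {v, u}) ` L"
    by blast
  obtain h where h: "bij_betw h {1..t} L"
    using ex_bij_betw_nat_finite_1[OF L(2)] L(3) by auto
  let ?g = "h(0 := v)"
  have img: "?g ` {1..t} = L"
    using h by (auto simp: bij_betw_def)
  have "inj_on ?g {1..t}"
    using h L(1) by (intro inj_on_fun_updI) (auto simp: bij_betw_def)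
  moreover have "?g 0 \<notin> ?g ` ({1..t} - {0})"
    using img L(1) by auto
  moreover have "{0..t} = insert 0 {1..t}"
    by auto
  ultimately have "inj_on ?g {0..t}"
    by (simp only: inj_on_insert simp_thms)
  moreover have "D = (`) ?g ` (\<lambda>i. {0, i}) ` {1..t}"
  proof -
    have "(`) ?g ` (\<lambda>i. {0, i}) ` {1..t} = (\<lambda>i. {v, h i}) ` {1..t}"
      unfolding image_image by (intro image_cong) auto
    also have "\<dots> = D"
      using h unfolding L(4) bij_betw_def by (auto simp flip: image_image)
    finally show ?thesis ..
  qed
  ultimately show "copy_of (star t) D"
    unfolding copy_of_def edges_star by (intro exI[of _ ?g]) (simp add: star_def)
qed

lemma copy_of_matchingD:
  assumes "copy_of (matching t) D"
  shows "card D = t" "\<And>e e'. e \<in> D \<Longrightarrow> e' \<in> D \<Longrightarrow> e \<noteq> e' \<Longrightarrow> e \<inter> e' = {}"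
proof -
  obtain g where g: "inj_on g {0..<2 * t}" "D = (`) g ` (\<lambda>i. {2 * i, 2 * i + 1}) ` {..<t}"
    using assms unfolding copy_of_def edges_matching by (auto simp: matching_def)
  have D: "D = (\<lambda>i. {g (2 * i), g (2 * i + 1)}) ` {..<t}"
    unfolding g(2) by (simp add: image_image)
  have disj: "{g (2 * i), g (2 * i + 1)} \<inter> {g (2 * j), g (2 * j + 1)} = {}" if "i < t" "j < t" "i \<noteq> j" for i j
  proof -
    have "g (2 * i + a) \<noteq> g (2 * j + b)" if "a \<le> 1" "b \<le> 1" for a b
    proof
      assume "g (2 * i + a) = g (2 * j + b)"
      then have "2 * i + a = 2 * j + b"
        using g(1) that \<open>i < t\<close> \<open>j < t\<close> by (auto dest!: inj_onD)
      then show False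
        using that \<open>i \<noteq> j\<close> by presburger
    qed
    from this[of 0 0] this[of 0 1] this[of 1 0] this[of 1 1] show ?thesis
      by auto
  qed
  then have "inj_on (\<lambda>i. {g (2 * i), g (2 * i + 1)}) {..<t}"
    by (intro inj_onI) (metis Int_absorb insert_not_empty lessThan_iff)
  then show "card D = t"
    unfolding D by (simp add: card_image)
  show "e \<inter> e' = {}" if e: "e \<in> D" "e' \<in> D" "e \<noteq> e'" for e e'
  proof -
    obtain i j where "i < t" "j < t" "e = {g (2 * i), g (2 * i + 1)}" "e' = {g (2 * j), g (2 * j + 1)}"
      using e(1,2) unfolding D by blast
    then show ?thesis
      using disj[of i j] e(3) by (cases "i = j") simp_all
  qed
qed

lemma copy_of_matchingI:
  fixes A :: "nat set"
  assumes "finite A" "card A = t"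
  shows "copy_of (matching t) ((\<lambda>i. {2 * i + 1, 2 * i + 2}) ` A)"
proof -
  obtain h where h: "bij_betw h {..<t} A"
    using ex_bij_betw_nat_finite[OF assms(1)] assms(2) by (auto simp: atLeast0LessThan)
  \<comment> \<open>Sends the edge \<open>{2 * i, 2 * i + 1}\<close> to
    \<open>{2 * h i + 1, 2 * h i + 2}\<close>; the shift by one is there because host vertices are
    numbered from 1.\<close>
  define g where "g j = 2 * h (j div 2) + 1 + j mod 2" for j
  have "inj_on g {0..<2 * t}"
  proof (rule inj_onI)
    fix i j assume ij: "i \<in> {0..<2 * t}" "j \<in> {0..<2 * t}" "g i = g j"
    then have "h (i div 2) = h (j div 2) \<and> i mod 2 = j mod 2"
      unfolding g_def by presburger
    moreover have "i div 2 < t" "j div 2 < t"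
      using ij by auto
    ultimately have "i div 2 = j div 2" "i mod 2 = j mod 2"
      using h by (auto simp: bij_betw_def inj_on_def)
    then show "i = j"
      by (metis div_mult_mod_eq)
  qed
  moreover have "(`) g ` (\<lambda>i. {2 * i, 2 * i + 1}) ` {..<t} = (\<lambda>i. {2 * i + 1, 2 * i + 2}) ` h ` {..<t}"
    by (simp add: g_def image_image)
  ultimately show ?thesis
    using h unfolding copy_of_def edges_matching by (intro exI[of _ g]) (simp add: matching_def bij_betw_def)
qed

section \<open>Bounds on the code density\<close>

lemma card_edges_complete: "finite V \<Longrightarrow> card (nsets V 2) = card V choose 2"
  using n_subsets[of V 2] by (simp add: nsets_def) (metis (mono_tags, lifting) Collect_cong finite_subset)

lemma simple_graph_iff_nsets: "finite V \<Longrightarrow> simple_graph (V, E) \<longleftrightarrow> E \<subseteq> nsets V 2"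
  by (auto simp: simple_graph_def nsets_def intro: finite_subset)

lemma graphs_on_eq: "graphs_on n = Pair {1..n} ` Pow (nsets {1..n} 2)"
  by (auto simp: graphs_on_def image_iff simple_graph_iff_nsets)

text \<open>All graphs of a code share the vertex set \<open>{1..n}\<close>, so from here on codes
  are handled as families of edge sets.\<close>

lemma H_code_Pair_iff:
  assumes "simple_graph H" "\<Union>(edges H) = verts H"
  shows "H_code H n (Pair {1..n} ` \<E>) \<longleftrightarrow> \<E> \<subseteq> Pow (nsets {1..n} 2) \<and>
    (\<forall>E\<in>\<E>. \<forall>E'\<in>\<E>. E \<noteq> E' \<longrightarrow> \<not> copy_of H (sym_diff E E'))"
proof -
  have "graph_iso (drop_isolated ({1..n}, sym_diff E E')) (drop_isolated H) \<longleftrightarrow> copy_of H (sym_diff E E')"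
    if "E \<subseteq> nsets {1..n} 2" "E' \<subseteq> nsets {1..n} 2" for E E'
    using that assms by (intro graph_iso_drop_isolated_iff) (auto simp: simple_graph_iff_nsets)
  note pair = this
  have iso: "graph_iso (drop_isolated ({1..n}, sym_diff E E')) (drop_isolated H) \<longleftrightarrow> copy_of H (sym_diff E E')"
    if "\<E> \<subseteq> Pow (nsets {1..n} 2)" "E \<in> \<E>" "E' \<in> \<E>" for E E'
    by (rule pair[of E E']; use that in blast)
  have sub: "Pair {1..n} ` \<E> \<subseteq> Pair {1..n} ` Pow (nsets {1..n} 2) \<longleftrightarrow> \<E> \<subseteq> Pow (nsets {1..n} 2)"
    by (rule inj_image_subset_iff) (simp add: inj_on_def)
  show ?thesis
    unfolding H_code_def graphs_on_eq sub
    by (intro conj_cong refl) (simp add: iso del: One_nat_def cong: ball_cong)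
qed

section \<open>Lower bound from a labelling of the edges\<close>

lemma sum_sym_diff_char2:
  fixes f :: "'b \<Rightarrow> bit alg_closure"
  assumes "finite A" "finite B"
  shows "sum f (sym_diff A B) = sum f A + sum f B"
proof -
  have "sum f A = sum f (A - B) + sum f (A \<inter> B)" "sum f B = sum f (B - A) + sum f (A \<inter> B)"
    using assms sum.Int_Diff[of A f B] sum.Int_Diff[of B f A] by (simp_all add: Int_commute add.commute)
  moreover have "sum f (sym_diff A B) = sum f (A - B) + sum f (B - A)"
    using assms by (intro sum.union_disjoint) auto
  moreover have "a + b = (a + c) + (b + c)" for a b c :: "bit alg_closure"
    using add_self_char2[of c] by (metis add.assoc add.commute add.right_neutral)
  ultimately show ?thesis
    by simp
qed

text \<open>\<open>f E\<close> is the BCH syndrome of \<open>E\<close>. Edge sets with equal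
  syndromes differ in a set whose odd power sums vanish, hence not in a copy of \<open>H\<close>, so
  every fibre of \<open>f\<close> is a code. There are at most \<open>(2 ^ m) ^ k\<close> fibres,
  and the largest has at least the average size.\<close>

lemma code_density_lower:
  assumes "k > 0" "m > 0" and H: "simple_graph H" "\<Union>(edges H) = verts H"
    and \<phi>: "\<And>e. e \<in> nsets {1..n} 2 \<Longrightarrow> \<phi> e \<in> GF_set m"
    and copy: "\<And>D. D \<subseteq> nsets {1..n} 2 \<Longrightarrow> copy_of H D \<Longrightarrow> card D = 2 * k \<and> inj_on \<phi> D"
  shows "code_density H n \<ge> 1 / (2 ^ m) ^ k"
proof -
  let ?K = "nsets {1..n} 2"
  have finK: "finite ?K"
    by (simp add: finite_imp_finite_nsets)
  have finE: "finite E" if "E \<in> Pow ?K" for E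
    using that finK finite_subset by auto
  define f where "f E = (\<lambda>j\<in>{..<k}. \<Sum>e\<in>E. \<phi> e ^ (2 * j + 1))" for E
  let ?B = "{..<k} \<rightarrow>\<^sub>E GF_set m"
  have finGF: "finite (GF_set m)"
    using card_GF_set[OF assms(2)] by (intro card_ge_0_finite) simp
  then have finB: "finite ?B"
    by (simp add: finite_PiE)
  have fB: "f ` Pow ?K \<subseteq> ?B"
  proof
    fix y assume "y \<in> f ` Pow ?K"
    then obtain E where E: "E \<subseteq> ?K" "y = f E"
      by blast
    have "(\<Sum>e\<in>E. \<phi> e ^ (2 * j + 1)) \<in> GF_set m" for j
      using E(1) \<phi> by (intro GF_set_sum GF_set_power) blast
    then show "y \<in> ?B"
      unfolding E(2) f_def restrict_PiE_iff by blast
  qed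
  have small: "card {E \<in> Pow ?K. f E = z} \<le> max_code H n" for z
  proof -
    let ?\<E> = "{E \<in> Pow ?K. f E = z}"
    have "\<not> copy_of H (sym_diff E E')" if E: "E \<in> ?\<E>" "E' \<in> ?\<E>" for E E'
    proof
      let ?D = "sym_diff E E'"
      assume "copy_of H ?D"
      moreover have "?D \<subseteq> ?K"
        using E by auto
      ultimately have D: "card ?D = 2 * k" "inj_on \<phi> ?D"
        using copy by auto
      have "(\<Sum>x\<in>\<phi> ` ?D. x ^ (2 * j + 1)) = 0" if "j < k" for j
      proof -
        have "f E j = f E' j"
          using E by simp
        then have "(\<Sum>e\<in>E. \<phi> e ^ (2 * j + 1)) = (\<Sum>e\<in>E'. \<phi> e ^ (2 * j + 1))"
          using that by (simp add: f_def)
        moreover have "(\<Sum>x\<in>\<phi> ` ?D. x ^ (2 * j + 1)) = (\<Sum>e\<in>?D. \<phi> e ^ (2 * j + 1))"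
          using D(2) by (simp add: sum.reindex)
        moreover have "\<dots> = (\<Sum>e\<in>E. \<phi> e ^ (2 * j + 1)) + (\<Sum>e\<in>E'. \<phi> e ^ (2 * j + 1))"
          using E finE by (intro sum_sym_diff_char2) auto
        ultimately show ?thesis
          by (simp only: add_self_char2)
      qed
      moreover have "card (\<phi> ` ?D) = 2 * k"
        using D by (simp add: card_image)
      ultimately show False
        using odd_power_sums_nonzero[of "\<phi> ` ?D" k] assms(1) by blast
    qed
    then have "H_code H n (Pair {1..n} ` ?\<E>)"
      by (subst H_code_Pair_iff[OF H]) auto
    then have "card (Pair {1..n} ` ?\<E>) \<le> max_code H n"
      by (rule H_code_card_le)
    then show ?thesis
      by (simp add: card_image inj_on_def)
  qed
  have "\<not> card ?B * max_code H n < card (Pow ?K)"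
  proof
    assume "card ?B * max_code H n < card (Pow ?K)"
    then obtain z where "max_code H n < card {E \<in> Pow ?K. f E = z}"
      using fibre_large[OF _ finB fB] finK by blast
    then show False
      using small[of z] by simp
  qed
  moreover have "card (Pow ?K) = 2 ^ (n choose 2)"
    using finK by (simp add: card_Pow card_edges_complete)
  moreover have "card ?B = (2 ^ m) ^ k"
    using card_GF_set[OF assms(2)] by (simp add: card_PiE)
  ultimately have "2 ^ (n choose 2) \<le> (2 ^ m) ^ k * max_code H n"
    by simp
  then have "real (2 ^ (n choose 2)) \<le> real ((2 ^ m) ^ k * max_code H n)"
    by (simp only: of_nat_le_iff)
  then show ?thesis
    by (simp add: code_density_def field_simps)
qed

section \<open>Upper bound by averaging over transversals\<close>

text \<open>Block \<open>c\<close> consists of the \<open>M\<close> numbers starting at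
  \<open>c * M\<close>, and \<open>T x\<close> picks the one with offset \<open>x c\<close>. Each
  coordinate where \<open>x\<close> and \<open>y\<close> differ contributes two elements to the
  symmetric difference.\<close>

lemma card_sym_diff_transversals:
  fixes M :: nat
  assumes "x \<in> {..<r} \<rightarrow>\<^sub>E {..<M}" "y \<in> {..<r} \<rightarrow>\<^sub>E {..<M}"
  defines "T \<equiv> \<lambda>x. (\<lambda>c. c * M + x c) ` {..<r}"
  shows "card (sym_diff (T x) (T y)) = 2 * card (differ x y)"
proof -
  have lt: "x c < M" "y c < M" if "c < r" for c
    using that assms(1,2) by auto
  have eq: "c = d \<and> a = b" if "c * M + a = d * M + b" "a < M" "b < M" for a b c d
    using that by (metis add.commute div_mult_self3 div_less add_0 gr_implies_not0 add_left_cancel)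
  have sub: "differ x y \<subseteq> {..<r}"
    by (rule differ_subset_PiE[OF assms(1,2)])
  have *: "T x - T y = (\<lambda>c. c * M + x c) ` differ x y" if h: "\<And>c. c < r \<Longrightarrow> x c < M" "\<And>c. c < r \<Longrightarrow> y c < M"
    "differ x y \<subseteq> {..<r}" for x y
  proof (intro Set.set_eqI iffI)
    fix i assume "i \<in> T x - T y"
    then obtain c where c: "c < r" "i = c * M + x c" "i \<notin> T y"
      by (auto simp: T_def)
    then have "x c \<noteq> y c"
      by (auto simp: T_def)
    then show "i \<in> (\<lambda>c. c * M + x c) ` differ x y"
      using c by (auto simp: differ_def)
  next
    fix i assume "i \<in> (\<lambda>c. c * M + x c) ` differ x y"
    then obtain c where c: "i = c * M + x c" "x c \<noteq> y c" "c < r"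
      using h(3) by (auto simp: differ_def)
    have "i \<notin> T y"
    proof
      assume "i \<in> T y"
      then obtain d where "d < r" "c * M + x c = d * M + y d"
        using c(1) by (auto simp: T_def)
      then show False
        using eq[of c "x c" d "y d"] h(1,2) c by auto
    qed
    then show "i \<in> T x - T y"
      using c by (auto simp: T_def)
  qed
  have "card ((\<lambda>c. c * M + z c) ` differ x y) = card (differ x y)" if "\<And>c. c < r \<Longrightarrow> z c < M" for z
    using that sub eq by (intro card_image inj_onI) (metis lessThan_iff subsetD)
  then have "card (T x - T y) = card (differ x y)" "card (T y - T x) = card (differ x y)"
    using *[of x y] *[of y x] lt sub by (simp_all add: differ_commute[of y x])
  moreover have "card (sym_diff (T x) (T y)) = card (T x - T y) + card (T y - T x)"
    by (intro card_Un_disjoint) (auto simp: T_def)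
  ultimately show ?thesis
    by simp
qed

text \<open>Pairs of an edge set \<open>E\<close> and a function \<open>x\<close> with
  \<open>sym_diff E (T x) \<in> \<E>\<close> are counted twice. For fixed \<open>x\<close> there are
  exactly \<open>card \<E>\<close>, as shifting by \<open>T x\<close> is an involution; for fixed
  \<open>E\<close> the admissible \<open>x\<close> avoid Hamming distance \<open>k\<close>, so there
  are at most \<open>C * M ^ (r - k)\<close>.\<close>

lemma code_density_upper:
  fixes M :: nat
  assumes "k > 0" "r \<ge> k" "M > 0"
    and H: "simple_graph H" "\<Union>(edges H) = verts H"
    and ham: "\<And>F. F \<subseteq> {..<r} \<rightarrow>\<^sub>E {..<M} \<Longrightarrow> card F > C * M ^ (r - k) \<Longrightarrow> \<exists>x\<in>F. \<exists>y\<in>F. card (differ x y) = k"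
    and \<epsilon>: "inj_on \<epsilon> {..<r * M}" "\<epsilon> ` {..<r * M} \<subseteq> nsets {1..n} 2"
    and copy: "\<And>A. A \<subseteq> {..<r * M} \<Longrightarrow> card A = 2 * k \<Longrightarrow> copy_of H (\<epsilon> ` A)"
  shows "code_density H n \<le> real C / real M ^ k"
proof -
  let ?K = "nsets {1..n} 2"
  let ?X = "{..<r} \<rightarrow>\<^sub>E {..<M}"
  have finK: "finite ?K"
    by (simp add: finite_imp_finite_nsets)
  obtain \<F> where \<F>: "H_code H n \<F>" "card \<F> = max_code H n"
    using max_code_attained by blast
  then obtain \<E> where \<E>: "\<F> = Pair {1..n} ` \<E>"
    unfolding H_code_def graphs_on_eq by (meson subset_imageE)
  have code: "\<E> \<subseteq> Pow ?K" "\<And>E E'. E \<in> \<E> \<Longrightarrow> E' \<in> \<E> \<Longrightarrow> E \<noteq> E' \<Longrightarrow> \<not> copy_of H (sym_diff E E')"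
    using \<F>(1) unfolding \<E> H_code_Pair_iff[OF H] by blast+
  have card\<E>: "card \<E> = max_code H n"
    using \<F>(2) unfolding \<E> by (simp add: card_image inj_on_def)
  define I where "I x = (\<lambda>c. c * M + x c) ` {..<r}" for x
  define T where "T x = \<epsilon> ` I x" for x
  have I: "I x \<subseteq> {..<r * M}" if "x \<in> ?X" for x
  proof
    fix i assume "i \<in> I x"
    then obtain c where c: "c < r" "i = c * M + x c"
      by (auto simp: I_def)
    then have "x c < M"
      using that by auto
    then have "i < (c + 1) * M"
      using c(2) by simp
    also have "\<dots> \<le> r * M"
      using c(1) by (intro mult_right_mono) auto
    finally show "i \<in> {..<r * M}"
      by simp
  qed
  have T: "T x \<subseteq> ?K" if "x \<in> ?X" for x
    using I[OF that] \<epsilon>(2) unfolding T_def by blast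
  have few: "card {x \<in> ?X. sym_diff E (T x) \<in> \<E>} \<le> C * M ^ (r - k)" for E
  proof (rule ccontr)
    assume "\<not> ?thesis"
    then obtain x y where xy: "x \<in> ?X" "y \<in> ?X" "sym_diff E (T x) \<in> \<E>" "sym_diff E (T y) \<in> \<E>" "card (differ x y) = k"
      using ham[of "{x \<in> ?X. sym_diff E (T x) \<in> \<E>}"] by (auto simp: not_le)
    let ?A = "sym_diff (I x) (I y)"
    have A: "?A \<subseteq> {..<r * M}" "card ?A = 2 * k"
      using I xy card_sym_diff_transversals[OF xy(1,2)] by (auto simp: I_def)
    have "\<epsilon> ` (I x - I y) = T x - T y" "\<epsilon> ` (I y - I x) = T y - T x"
      unfolding T_def using I[OF xy(1)] I[OF xy(2)] by (intro inj_on_image_set_diff[OF \<epsilon>(1)]; blast)+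
    then have "\<epsilon> ` ?A = sym_diff (T x) (T y)"
      by (simp add: image_Un)
    \<comment> \<open>The common shift by \<open>E\<close> cancels.\<close>
    also have "\<dots> = sym_diff (sym_diff E (T x)) (sym_diff E (T y))"
      by blast
    finally have eq: "\<epsilon> ` ?A = sym_diff (sym_diff E (T x)) (sym_diff E (T y))" .
    \<comment> \<open>The code condition concerns distinct members only, so the two shifts must be
      shown to differ.\<close>
    have "?A \<noteq> {}"
      using A(2) assms(1) by (metis card.empty mult_is_0 neq0_conv zero_neq_numeral)
    then have "sym_diff E (T x) \<noteq> sym_diff E (T y)"
      using eq by (metis Diff_cancel Un_empty image_is_empty)
    then show False
      using code(2)[OF xy(3,4)] copy[OF A] eq by simp
  qed
  have "card {E \<in> Pow ?K. sym_diff E (T x) \<in> \<E>} = card \<E>" if "x \<in> ?X" for x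
  proof (rule bij_betw_same_card)
    show "bij_betw (\<lambda>E. sym_diff E (T x)) {E \<in> Pow ?K. sym_diff E (T x) \<in> \<E>} \<E>"
    proof (rule bij_betw_byWitness[where f' = "\<lambda>E. sym_diff E (T x)"])
      have inv: "sym_diff (sym_diff E (T x)) (T x) = E" for E
        by blast
      show "\<forall>E\<in>{E \<in> Pow ?K. sym_diff E (T x) \<in> \<E>}. sym_diff (sym_diff E (T x)) (T x) = E"
        "\<forall>E\<in>\<E>. sym_diff (sym_diff E (T x)) (T x) = E"
        using inv by blast+
      show "(\<lambda>E. sym_diff E (T x)) ` \<E> \<subseteq> {E \<in> Pow ?K. sym_diff E (T x) \<in> \<E>}"
      proof
        fix G assume "G \<in> (\<lambda>E. sym_diff E (T x)) ` \<E>"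
        then obtain E where E: "E \<in> \<E>" "G = sym_diff E (T x)"
          by blast
        then have "sym_diff G (T x) \<in> \<E>" "G \<subseteq> ?K"
          using inv[of E] T[OF that] code(1) by auto
        then show "G \<in> {E \<in> Pow ?K. sym_diff E (T x) \<in> \<E>}"
          by blast
      qed
    qed blast
  qed
  then have "(\<Sum>E\<in>Pow ?K. card {x \<in> ?X. sym_diff E (T x) \<in> \<E>}) = (\<Sum>x\<in>?X. card \<E>)"
    using finK by (intro sum_multicount_gen) (auto simp: finite_PiE)
  also have "\<dots> = M ^ r * max_code H n"
    by (simp add: card_PiE card\<E>)
  finally have "M ^ r * max_code H n \<le> card (Pow ?K) * (C * M ^ (r - k))"
    using sum_bounded_above[of "Pow ?K" "\<lambda>E. card {x \<in> ?X. sym_diff E (T x) \<in> \<E>}" "C * M ^ (r - k)"] few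
    by simp
  moreover have "card (Pow ?K) = 2 ^ (n choose 2)"
    using finK by (simp add: card_Pow card_edges_complete)
  moreover have "M ^ r = M ^ (r - k) * M ^ k"
    using assms(2) by (simp flip: power_add)
  ultimately have "M ^ (r - k) * (M ^ k * max_code H n) \<le> M ^ (r - k) * (C * 2 ^ (n choose 2))"
    by (simp add: mult_ac)
  then have "M ^ k * max_code H n \<le> C * 2 ^ (n choose 2)"
    using assms(3) by simp
  then have "real (M ^ k * max_code H n) \<le> real (C * 2 ^ (n choose 2))"
    by (simp only: of_nat_le_iff)
  then show ?thesis
    using assms(3) by (simp add: code_density_def field_simps)
qed

section \<open>Asymptotic form for a general graph\<close>

text \<open>With \<open>m\<close> least such that \<open>n \<le> 2 ^ m\<close>, the vertices embed
  into the field while \<open>2 ^ m \<le> 2 * n\<close>, which costs only the factor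
  \<open>2 ^ k\<close>.\<close>

lemma code_density_ge:
  assumes "k > 0" "n \<ge> 2" and H: "simple_graph H" "\<Union>(edges H) = verts H"
    and label: "\<And>m g. inj_on g {1..n} \<Longrightarrow> g ` {1..n} \<subseteq> GF_set m \<Longrightarrow>
      \<exists>\<phi>. (\<forall>e\<in>nsets {1..n} 2. \<phi> e \<in> GF_set m) \<and>
          (\<forall>D\<subseteq>nsets {1..n} 2. copy_of H D \<longrightarrow> card D = 2 * k \<and> inj_on \<phi> D)"
  shows "code_density H n \<ge> 1 / 2 ^ k * (1 / real n ^ k)"
proof -
  obtain l where l: "2 ^ l < n" "n \<le> 2 ^ (l + 1)"
    using ex_power_ivl2[of 2 n] assms(2) by auto
  define m where "m = l + 1"
  have m: "m > 0" "n \<le> 2 ^ m" "2 ^ m \<le> 2 * n"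
    using l by (auto simp: m_def)
  have "finite (GF_set m)"
    using card_GF_set[OF m(1)] by (intro card_ge_0_finite) simp
  then obtain g where "g ` {1..n} \<subseteq> GF_set m" "inj_on g {1..n}"
    using card_le_inj[of "{1..n}" "GF_set m"] card_GF_set[OF m(1)] m(2) by auto
  then obtain \<phi> where "\<forall>e\<in>nsets {1..n} 2. \<phi> e \<in> GF_set m"
      "\<forall>D\<subseteq>nsets {1..n} 2. copy_of H D \<longrightarrow> card D = 2 * k \<and> inj_on \<phi> D"
    using label by blast
  then have "1 / (2 ^ m) ^ k \<le> code_density H n"
    by (intro code_density_lower[OF assms(1) m(1) H, of n \<phi>]) auto
  moreover have "1 / (2 * real n) ^ k \<le> 1 / (2 ^ m) ^ k"
  proof -
    have "(2 ^ m :: real) \<le> 2 * real n"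
      using m(3) by (metis of_nat_le_iff of_nat_mult of_nat_numeral of_nat_power)
    then show ?thesis
      by (intro divide_left_mono power_mono mult_pos_pos) (use assms(2) in auto)
  qed
  ultimately show ?thesis
    by (simp add: power_mult_distrib)
qed

lemma code_density_bigo:
  assumes "k > 0" and H: "simple_graph H" "\<Union>(edges H) = verts H"
    and \<epsilon>: "inj \<epsilon>" "\<And>n i. i < (n - 1) div 2 \<Longrightarrow> \<epsilon> i \<in> nsets {1..n} 2"
    and copy: "\<And>A :: nat set. finite A \<Longrightarrow> card A = 2 * k \<Longrightarrow> copy_of H (\<epsilon> ` A)"
  shows "(\<lambda>n. code_density H n) \<in> O(\<lambda>n. 1 / real n ^ k)"
proof -
  obtain r C where r: "r \<ge> k" and ham: "\<And>M F. F \<subseteq> {..<r} \<rightarrow>\<^sub>E {..<M::nat} \<Longrightarrow>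
      card F > C * M ^ (r - k) \<Longrightarrow> \<exists>x\<in>F. \<exists>y\<in>F. card (differ x y) = k"
    using hamming_distance_unavoidable[OF assms(1)] by blast
  show ?thesis
  proof (rule bigoI[of _ "real C * (4 * real r) ^ k"], rule eventually_sequentiallyI)
    fix n assume n: "4 * r + 2 \<le> n"
    \<comment> \<open>The largest block size for which \<open>r\<close> blocks fit into the
      \<open>(n - 1) div 2\<close> available edges.\<close>
    define M where "M = (n - 1) div 2 div r"
    have rM: "r * M \<le> (n - 1) div 2"
      by (simp add: M_def)
    have "r > 0"
      using r assms(1) by simp
    then have "(n - 1) div 2 < r * M + r"
      using mult_div_mod_eq[of r "(n - 1) div 2"] mod_less_divisor[of r "(n - 1) div 2"]
      unfolding M_def by linarith
    \<comment> \<open>Rounding loses fewer than \<open>r\<close> edges, so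
      \<open>n \<le> 2 * r * M + 2 * r\<close>, and \<open>2 * r\<close> is below
      \<open>n / 2\<close> since \<open>n \<ge> 4 * r + 2\<close>.\<close>
    then have M: "n \<le> 4 * r * M" "M > 0"
      using n by (auto intro: Nat.gr0I)
    have "code_density H n \<le> real C / real M ^ k"
    proof (rule code_density_upper[OF assms(1) r M(2) H ham])
      show "inj_on \<epsilon> {..<r * M}"
        using \<epsilon>(1) by (rule inj_on_subset) simp
      show "\<epsilon> ` {..<r * M} \<subseteq> nsets {1..n} 2"
        using \<epsilon>(2) rM by fastforce
      show "copy_of H (\<epsilon> ` A)" if "A \<subseteq> {..<r * M}" "card A = 2 * k" for A
        using that by (intro copy finite_subset[OF that(1)]) auto
    qed
    also have "\<dots> = real C * (4 * real r) ^ k / (4 * real r * real M) ^ k"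
      using \<open>r > 0\<close> by (simp add: power_mult_distrib)
    also have "\<dots> \<le> real C * (4 * real r) ^ k / real n ^ k"
    proof (intro divide_left_mono power_mono)
      show "real n \<le> 4 * real r * real M"
        using M(1) by (metis of_nat_le_iff of_nat_mult of_nat_numeral)
    qed (use n \<open>r > 0\<close> M(2) in auto)
    finally show "norm (code_density H n) \<le> real C * (4 * real r) ^ k * norm (1 / real n ^ k)"
      by (simp add: code_density_def)
  qed
qed

text \<open>Collects what stars and matchings have in common: an edge sequence any
  \<open>2 * k\<close> terms of which form a copy, and edge labels that are distinct within every
  copy. The range \<open>(n - 1) div 2\<close> is chosen to suit both sequences.\<close>

lemma code_density_bigtheta:
  assumes "k > 0" and H: "simple_graph H" "\<Union>(edges H) = verts H"
    and \<epsilon>: "inj \<epsilon>" "\<And>n i. i < (n - 1) div 2 \<Longrightarrow> \<epsilon> i \<in> nsets {1..n} 2"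
    and copy: "\<And>A :: nat set. finite A \<Longrightarrow> card A = 2 * k \<Longrightarrow> copy_of H (\<epsilon> ` A)"
    and label: "\<And>(n :: nat) m g. inj_on g {1..n} \<Longrightarrow> g ` {1..n} \<subseteq> GF_set m \<Longrightarrow>
      \<exists>\<phi>. (\<forall>e\<in>nsets {1..n} 2. \<phi> e \<in> GF_set m) \<and>
          (\<forall>D\<subseteq>nsets {1..n} 2. copy_of H D \<longrightarrow> card D = 2 * k \<and> inj_on \<phi> D)"
  shows "(\<lambda>n. code_density H n) \<in> \<Theta>(\<lambda>n. 1 / real n ^ k)"
proof (rule bigthetaI)
  show "(\<lambda>n. code_density H n) \<in> O(\<lambda>n. 1 / real n ^ k)"
    using code_density_bigo[OF assms(1) H \<epsilon> copy] by blast
  show "(\<lambda>n. code_density H n) \<in> \<Omega>(\<lambda>n. 1 / real n ^ k)"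
  proof (rule landau_omega.bigI[of "1 / 2 ^ k"])
    show "eventually (\<lambda>n. norm (code_density H n) \<ge> 1 / 2 ^ k * norm (1 / real n ^ k)) sequentially"
    proof (rule eventually_sequentiallyI)
      fix n :: nat assume n: "2 \<le> n"
      have "1 / 2 ^ k * (1 / real n ^ k) \<le> code_density H n"
        by (rule code_density_ge[OF assms(1) n H label])
      then show "1 / 2 ^ k * norm (1 / real n ^ k) \<le> norm (code_density H n)"
        by (simp add: code_density_def)
    qed
  qed simp
qed

section \<open>Labellings for stars and matchings\<close>

text \<open>The label \<open>sum g e\<close> is the sum of the two end labels. Edges of a star share
  the centre, whose label cancels, so equal sums force equal leaves.\<close>

lemma star_labelling:
  fixes g :: "nat \<Rightarrow> bit alg_closure"
  assumes "inj_on g {1..n}" "g ` {1..n} \<subseteq> GF_set m" "t > 0"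
  shows "\<exists>\<phi>. (\<forall>e\<in>nsets {1..n} 2. \<phi> e \<in> GF_set m) \<and>
    (\<forall>D\<subseteq>nsets {1..n} 2. copy_of (star t) D \<longrightarrow> card D = t \<and> inj_on \<phi> D)"
proof (intro exI[of _ "sum g"] conjI ballI allI impI)
  fix e assume "e \<in> nsets {1..n} 2"
  then show "sum g e \<in> GF_set m"
    using assms(2) by (intro GF_set_sum) (auto simp: nsets_def)
next
  fix D assume D: "D \<subseteq> nsets {1..n} 2" "copy_of (star t) D"
  then obtain v L where L: "v \<notin> L" "card L = t" "D = (\<lambda>u. {v, u}) ` L"
    unfolding copy_of_star_iff by blast
  have "inj_on (\<lambda>u. {v, u}) L"
    by (auto simp: inj_on_def doubleton_eq_iff)
  then show "card D = t"
    using L by (simp add: card_image)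
  show "inj_on (sum g) D"
  proof (rule inj_onI)
    fix e e' assume e: "e \<in> D" "e' \<in> D" "sum g e = sum g e'"
    then obtain u u' where u: "u \<in> L" "u' \<in> L" "e = {v, u}" "e' = {v, u'}"
      using L(3) by blast
    have "u \<noteq> v" "u' \<noteq> v"
      using u L(1) by auto
    then have "g u = g u'"
      using e(3) u by simp
    moreover have "u \<in> {1..n}" "u' \<in> {1..n}"
      using D(1) e(1,2) u by (auto simp: nsets_def)
    ultimately show "e = e'"
      using assms(1) u by (auto dest: inj_onD)
  qed
qed

text \<open>Disjoint edges have different minima, so the label of the smaller end separates the
  edges of a matching.\<close>

lemma matching_labelling:
  fixes g :: "nat \<Rightarrow> bit alg_closure"
  assumes "inj_on g {1..n}" "g ` {1..n} \<subseteq> GF_set m"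
  shows "\<exists>\<phi>. (\<forall>e\<in>nsets {1..n} 2. \<phi> e \<in> GF_set m) \<and>
    (\<forall>D\<subseteq>nsets {1..n} 2. copy_of (matching t) D \<longrightarrow> card D = t \<and> inj_on \<phi> D)"
proof -
  have Min: "Min e \<in> e \<and> Min e \<in> {1..n}" if "e \<in> nsets {1..n} 2" for e
  proof -
    have "finite e" "e \<noteq> {}" "e \<subseteq> {1..n}"
      using that by (auto simp: nsets_def)
    then show ?thesis
      using Min_in by blast
  qed
  show ?thesis
  proof (intro exI[of _ "\<lambda>e. g (Min e)"] conjI ballI allI impI)
    fix e assume "e \<in> nsets {1..n} 2"
    then show "g (Min e) \<in> GF_set m"
      using Min assms(2) by blast
  next
    fix D assume D: "D \<subseteq> nsets {1..n} 2" "copy_of (matching t) D"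
    show "card D = t"
      using D(2) by (rule copy_of_matchingD)
    show "inj_on (\<lambda>e. g (Min e)) D"
    proof (rule inj_onI)
      fix e e' assume e: "e \<in> D" "e' \<in> D" "g (Min e) = g (Min e')"
      have "e \<in> nsets {1..n} 2" "e' \<in> nsets {1..n} 2"
        using D(1) e by auto
      then have "Min e \<in> e" "Min e' \<in> e'" "Min e = Min e'"
        using Min inj_onD[OF assms(1) e(3)] by blast+
      then have "e \<inter> e' \<noteq> {}"
        by (metis disjoint_iff)
      then show "e = e'"
        using copy_of_matchingD(2)[OF D(2) e(1,2)] by blast
    qed
  qed
qed

theorem theorem1p2:
  fixes k :: nat
  assumes "k > 0"
  shows "(\<lambda>n. code_density (star (2 * k)) n) \<in> \<Theta>(\<lambda>n. 1 / real n ^ k) \<and>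
         (\<lambda>n. code_density (matching (2 * k)) n) \<in> \<Theta>(\<lambda>n. 1 / real n ^ k)"
proof
  have k: "2 * k > 0"
    using assms by simp
  show "(\<lambda>n. code_density (star (2 * k)) n) \<in> \<Theta>(\<lambda>n. 1 / real n ^ k)"
  proof (rule code_density_bigtheta[OF assms simple_graph_star Union_edges_star[OF k]])
    \<comment> \<open>All edges at vertex 1; the offset 2 makes the leaves start just after the
      centre.\<close>
    let ?\<epsilon> = "\<lambda>i :: nat. {1, i + 2}"
    show "inj ?\<epsilon>"
      by (auto simp: inj_def doubleton_eq_iff)
    show "?\<epsilon> i \<in> nsets {1..n} 2" if "i < (n - 1) div 2" for n i
      using that by (auto simp: nsets_def)
    show "copy_of (star (2 * k)) (?\<epsilon> ` A)" if "finite A" "card A = 2 * k" for A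
      unfolding copy_of_star_iff
    proof (intro exI conjI)
      show "1 \<notin> (\<lambda>i. i + 2) ` A"
        by auto
      show "?\<epsilon> ` A = (\<lambda>u. {1, u}) ` (\<lambda>i. i + 2) ` A"
        by (simp only: image_image)
      show "card ((\<lambda>i. i + 2) ` A) = 2 * k"
        using that(2) by (subst card_image) (auto simp: inj_on_def)
    qed (use that in simp)
    show "\<exists>\<phi>. (\<forall>e\<in>nsets {1..n} 2. \<phi> e \<in> GF_set m) \<and>
      (\<forall>D\<subseteq>nsets {1..n} 2. copy_of (star (2 * k)) D \<longrightarrow> card D = 2 * k \<and> inj_on \<phi> D)"
      if "inj_on g {1..n}" "g ` {1..n} \<subseteq> GF_set m" for n :: nat and m g
      using star_labelling[OF that k] .
  qed
  show "(\<lambda>n. code_density (matching (2 * k)) n) \<in> \<Theta>(\<lambda>n. 1 / real n ^ k)"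
  proof (rule code_density_bigtheta[OF assms simple_graph_matching Union_edges_matching])
    \<comment> \<open>Consecutive vertices are paired, starting from vertex 1.\<close>
    let ?\<epsilon> = "\<lambda>i :: nat. {2 * i + 1, 2 * i + 2}"
    show "inj ?\<epsilon>"
      by (auto simp: inj_def doubleton_eq_iff)
    show "?\<epsilon> i \<in> nsets {1..n} 2" if "i < (n - 1) div 2" for n i
      using that by (auto simp: nsets_def)
    show "copy_of (matching (2 * k)) (?\<epsilon> ` A)" if "finite A" "card A = 2 * k" for A
      using that by (rule copy_of_matchingI)
    show "\<exists>\<phi>. (\<forall>e\<in>nsets {1..n} 2. \<phi> e \<in> GF_set m) \<and>
      (\<forall>D\<subseteq>nsets {1..n} 2. copy_of (matching (2 * k)) D \<longrightarrow> card D = 2 * k \<and> inj_on \<phi> D)"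
      if "inj_on g {1..n}" "g ` {1..n} \<subseteq> GF_set m" for n :: nat and m g
      using matching_labelling[OF that] .
  qed
qed

end
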